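(* Let $(X,T)$ be a dynamical system. If $(X,T)$ is transitive, then $(X,T)$ is either almost mean equicontinuous or mean sensitive.
   Context: A dynamical system $(X,T)$ is a compact metric space $(X,d)$ together with a continuous map $T\colon X\to X$. $B(x,\varepsilon)$ is the open ball. $\omega(x,T)=\bigcap_{N\ge0}\overline{\{T^nx\colon n\ge N\}}$. $(X,T)$ is transitive if $\omega(x,T)=X$ for some $x\in X$. A point $x\in X$ is mean equicontinuous if for every $\varepsilon>0$ there is $\delta>0$ such that for every $y\in B(x,\delta)$, $\limsup_{n\to\infty}\frac1n\sum_{i=0}^{n-1}d(T^ix,T^iy)<\varepsilon$. A transitive system is almost mean equicontinuous if it has at least one mean equicontinuous point. $(X,T)$ is mean sensitive if there is $\delta>0$ such that for every $x\in X$ and every $\varepsilon>0$ there is $y\in B(x,\varepsilon)$ with $\limsup_{n\to\infty}\frac1n\sum_{i=0}^{n-1}d(T^ix,T^iy)>\delta$. *)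

theory Defs
  imports "HOL-Analysis.Analysis"
begin

text \<open>
  The compact metric space is a compact subset \<open>X\<close> of a type of class \<open>metric_space\<close>, with the
  induced metric. Open balls of the space are therefore \<open>ball x r \<inter> X\<close>, and \<open>T\<close> matters only
  on \<open>X\<close>.
\<close>

definition dynamical_system :: "'a::metric_space set \<Rightarrow> ('a \<Rightarrow> 'a) \<Rightarrow> bool" where
  "dynamical_system X T \<longleftrightarrow> compact X \<and> continuous_on X T \<and> T ` X \<subseteq> X"

text \<open>
  For \<open>x \<in> X\<close> the orbit stays in the closed set \<open>X\<close>, so the closure in the ambient type
  agrees with the closure in \<open>X\<close>.
\<close>

definition omega_limit :: "('a::metric_space \<Rightarrow> 'a) \<Rightarrow> 'a \<Rightarrow> 'a set" where
  "omega_limit T x = (\<Inter>N. closure {(T ^^ n) x | n. n \<ge> N})"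

definition transitive_system :: "'a::metric_space set \<Rightarrow> ('a \<Rightarrow> 'a) \<Rightarrow> bool" where
  "transitive_system X T \<longleftrightarrow> dynamical_system X T \<and> (\<exists>x\<in>X. omega_limit T x = X)"

text \<open>
  The upper limit is taken in \<open>ereal\<close>, since \<open>limsup\<close> needs a complete lattice; on a compact
  space it is finite. The term for \<open>n = 0\<close> is \<open>0 / 0 = 0\<close> and does not affect it.
\<close>

definition mean_dist :: "('a::metric_space \<Rightarrow> 'a) \<Rightarrow> 'a \<Rightarrow> 'a \<Rightarrow> ereal" where
  "mean_dist T x y =
     limsup (\<lambda>n. ereal (1 / real n * (\<Sum>i<n. dist ((T ^^ i) x) ((T ^^ i) y))))"

definition mean_equicontinuous_point :: "'a::metric_space set \<Rightarrow> ('a \<Rightarrow> 'a) \<Rightarrow> 'a \<Rightarrow> bool" where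
  "mean_equicontinuous_point X T x \<longleftrightarrow>
     x \<in> X \<and> (\<forall>\<epsilon>::real. \<epsilon> > 0 \<longrightarrow>
       (\<exists>\<delta>>0. \<forall>y \<in> ball x \<delta> \<inter> X. mean_dist T x y < ereal \<epsilon>))"

definition almost_mean_equicontinuous :: "'a::metric_space set \<Rightarrow> ('a \<Rightarrow> 'a) \<Rightarrow> bool" where
  "almost_mean_equicontinuous X T \<longleftrightarrow>
     transitive_system X T \<and> (\<exists>x. mean_equicontinuous_point X T x)"

definition mean_sensitive :: "'a::metric_space set \<Rightarrow> ('a \<Rightarrow> 'a) \<Rightarrow> bool" where
  "mean_sensitive X T \<longleftrightarrow>
     (\<exists>\<delta>::real. \<delta> > 0 \<and>
       (\<forall>x\<in>X. \<forall>\<epsilon>>0. \<exists>y \<in> ball x \<epsilon> \<inter> X. mean_dist T x y > ereal \<delta>))"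

end

theory Submission
  imports Defs
begin

text \<open>
  If \<open>T\<close> is not mean sensitive, then for every \<open>\<eta> > 0\<close> there is a ball around some \<open>x\<close> on which
  the mean distance to \<open>x\<close> is at most \<open>\<eta>\<close>. The orbit of a transitive point \<open>x\<^sub>0\<close> enters this
  ball, at time \<open>n\<close> say, and by continuity \<open>T\<^sup>n\<close> maps a neighbourhood of \<open>x\<^sub>0\<close> into it. Since
  finitely many initial terms do not matter for the mean distance, all points of that
  neighbourhood have mean distance at most \<open>2\<eta>\<close> to \<open>x\<^sub>0\<close>. Hence \<open>x\<^sub>0\<close>, which does not depend on
  \<open>\<eta>\<close>, is a mean equicontinuous point.
\<close>

lemma mean_dist_commute: "mean_dist T x y = mean_dist T y x"
  by (simp add: mean_dist_def dist_commute)

lemma mean_dist_triangle: "mean_dist T x z \<le> mean_dist T x y + mean_dist T y z"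
proof -
  let ?m = "\<lambda>x y n. 1 / real n * (\<Sum>i<n. dist ((T ^^ i) x) ((T ^^ i) y))"
  have "?m x z n \<le> ?m x y n + ?m y z n" for n
    unfolding distrib_left[symmetric] sum.distrib[symmetric]
    by (intro mult_left_mono sum_mono dist_triangle) simp
  then have "mean_dist T x z \<le> limsup (\<lambda>n. ereal (?m x y n) + ereal (?m y z n))"
    unfolding mean_dist_def by (intro Limsup_mono always_eventually) simp
  also have "\<dots> \<le> mean_dist T x y + mean_dist T y z"
    unfolding mean_dist_def by (rule ereal_limsup_add_mono)
  finally show ?thesis .
qed

text \<open>Passing to the images drops only the summand \<open>dist x y\<close> at
  \<open>i = 0\<close>; after division by \<open>n\<close> it tends to 0.\<close>

lemma mean_dist_le_step: "mean_dist T x y \<le> mean_dist T (T x) (T y)"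
proof -
  let ?d = "\<lambda>i. dist ((T ^^ i) x) ((T ^^ i) y)"
  have "(\<Sum>i<n. ?d i) \<le> dist x y + (\<Sum>i<n. ?d (Suc i))" for n
  proof -
    \<comment> \<open>With one extra summand, splitting off \<open>i = 0\<close> leaves a shifted
      sum of exactly \<open>n\<close> terms, which matches the factor
      \<open>1 / real n\<close>.\<close>
    have "(\<Sum>i<n. ?d i) \<le> (\<Sum>i<Suc n. ?d i)"
      by simp
    then show ?thesis
      by (simp only: sum.lessThan_Suc_shift) simp
  qed
  then have "1 / real n * (\<Sum>i<n. ?d i)
      \<le> 1 / real n * dist x y + 1 / real n * (\<Sum>i<n. ?d (Suc i))" for n
    unfolding distrib_left[symmetric] by (intro mult_left_mono) simp_all
  then have "mean_dist T x y
      \<le> limsup (\<lambda>n. ereal (1 / real n * dist x y) + ereal (1 / real n * (\<Sum>i<n. ?d (Suc i))))"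
    unfolding mean_dist_def by (intro Limsup_mono always_eventually) simp
  also have "\<dots> \<le> limsup (\<lambda>n. ereal (1 / real n * dist x y))
      + limsup (\<lambda>n. ereal (1 / real n * (\<Sum>i<n. ?d (Suc i))))"
    by (rule ereal_limsup_add_mono)
  also have "limsup (\<lambda>n. ereal (1 / real n * dist x y)) = 0"
  proof -
    have "(\<lambda>n. 1 / real n * dist x y) \<longlonglongrightarrow> 0"
      using tendsto_mult_left_zero[OF lim_1_over_n] by simp
    then have "(\<lambda>n. ereal (1 / real n * dist x y)) \<longlonglongrightarrow> ereal 0"
      by (rule tendsto_ereal)
    then show ?thesis
      by (simp add: lim_imp_Limsup zero_ereal_def)
  qed
  also have "limsup (\<lambda>n. ereal (1 / real n * (\<Sum>i<n. ?d (Suc i)))) = mean_dist T (T x) (T y)"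
    by (simp add: mean_dist_def funpow_swap1)
  finally show ?thesis
    by simp
qed

lemma mean_dist_le_funpow: "mean_dist T x y \<le> mean_dist T ((T ^^ n) x) ((T ^^ n) y)"
proof (induction n)
  case (Suc n)
  then show ?case
    using mean_dist_le_step[of T "(T ^^ n) x" "(T ^^ n) y"] by simp
qed simp

lemma dynamical_system_funpow:
  assumes "dynamical_system X T"
  shows "continuous_on X (T ^^ n)" and "(T ^^ n) ` X \<subseteq> X"
proof -
  have "continuous_on X (T ^^ n) \<and> (T ^^ n) ` X \<subseteq> X"
  proof (induction n)
    case (Suc n)
    then have "continuous_on ((T ^^ n) ` X) T"
      using assms continuous_on_subset unfolding dynamical_system_def by blast
    with Suc show ?case
      using assms continuous_on_compose[of X "T ^^ n" T]
      by (auto simp: dynamical_system_def)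
  qed simp
  then show "continuous_on X (T ^^ n)" and "(T ^^ n) ` X \<subseteq> X"
    by auto
qed

lemma transitive_point_mean_equicontinuous:
  assumes sys: "dynamical_system X T"
    and x0: "x0 \<in> X" "omega_limit T x0 = X"
    and nonsens: "\<not> mean_sensitive X T"
  shows "mean_equicontinuous_point X T x0"
  unfolding mean_equicontinuous_point_def
proof (intro conjI allI impI)
  fix \<epsilon> :: real
  assume "\<epsilon> > 0"
  \<comment> \<open>Failure of sensitivity for the constant \<open>\<epsilon> / 3\<close> gives a
    non-strict bound; two such bounds add up to strictly less than
    \<open>\<epsilon>\<close>.\<close>
  then obtain x r where x: "x \<in> X" "r > 0"
    and close: "\<And>y. y \<in> ball x r \<inter> X \<Longrightarrow> mean_dist T x y \<le> ereal (\<epsilon> / 3)"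
    using nonsens unfolding mean_sensitive_def
    by (metis divide_pos_pos not_less zero_less_numeral)
  \<comment> \<open>This is the member \<open>N = 0\<close> of the intersection
    \<open>omega_limit T x0\<close>.\<close>
  have "x \<in> closure {(T ^^ n) x0 | n. n \<ge> 0}"
    using x x0 unfolding omega_limit_def by blast
  then obtain n where n: "dist ((T ^^ n) x0) x < r"
    using \<open>r > 0\<close> unfolding closure_approachable by blast
  \<comment> \<open>A ball of this radius around \<open>(T ^^ n) x0\<close> lies inside
    \<open>ball x r\<close>.\<close>
  then have "r - dist ((T ^^ n) x0) x > 0"
    by simp
  then obtain \<delta> where "\<delta> > 0"
    and \<delta>: "\<And>y. y \<in> X \<Longrightarrow> dist y x0 < \<delta> \<Longrightarrow>
      dist ((T ^^ n) y) ((T ^^ n) x0) < r - dist ((T ^^ n) x0) x"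
    using dynamical_system_funpow(1)[OF sys, of n] x0(1) unfolding continuous_on_iff by metis
  have "mean_dist T x0 y < ereal \<epsilon>" if y: "y \<in> ball x0 \<delta> \<inter> X" for y
  proof -
    have "dist ((T ^^ n) y) ((T ^^ n) x0) < r - dist ((T ^^ n) x0) x"
      using \<delta>[of y] y by (simp add: dist_commute)
    then have "dist ((T ^^ n) y) x < r"
      using dist_triangle[of "(T ^^ n) y" x "(T ^^ n) x0"] by simp
    then have "(T ^^ n) y \<in> ball x r \<inter> X" "(T ^^ n) x0 \<in> ball x r \<inter> X"
      using n y x0(1) dynamical_system_funpow(2)[OF sys, of n] by (auto simp: dist_commute)
    then have *: "mean_dist T x ((T ^^ n) y) \<le> ereal (\<epsilon> / 3)"
        "mean_dist T ((T ^^ n) x0) x \<le> ereal (\<epsilon> / 3)"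
      using close mean_dist_commute by metis+
    have "mean_dist T x0 y \<le> mean_dist T ((T ^^ n) x0) ((T ^^ n) y)"
      by (rule mean_dist_le_funpow)
    also have "\<dots> \<le> mean_dist T ((T ^^ n) x0) x + mean_dist T x ((T ^^ n) y)"
      by (rule mean_dist_triangle)
    also have "\<dots> \<le> ereal (\<epsilon> / 3) + ereal (\<epsilon> / 3)"
      using * by (intro add_mono)
    also have "\<dots> < ereal \<epsilon>"
      using \<open>\<epsilon> > 0\<close> by simp
    finally show ?thesis .
  qed
  with \<open>\<delta> > 0\<close> show "\<exists>\<delta>>0. \<forall>y\<in>ball x0 \<delta> \<inter> X. mean_dist T x0 y < ereal \<epsilon>"
    by blast
qed (rule x0(1))

text \<open>This makes the alternative exclusive. With the sensitivity constant as
  \<open>\<epsilon>\<close>, all mean distances from \<open>x\<close> within some ball stay below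
  it, yet sensitivity at \<open>x\<close> yields a point of that ball exceeding it.\<close>

lemma mean_equicontinuous_point_not_mean_sensitive:
  assumes "mean_equicontinuous_point X T x"
  shows "\<not> mean_sensitive X T"
  using assms unfolding mean_equicontinuous_point_def mean_sensitive_def
  by (meson less_asym)

theorem theorem5p4:
  fixes X :: "'a::metric_space set" and T :: "'a \<Rightarrow> 'a"
  assumes "dynamical_system X T"
    and "transitive_system X T"
  shows "(almost_mean_equicontinuous X T \<or> mean_sensitive X T)
    \<and> \<not> (almost_mean_equicontinuous X T \<and> mean_sensitive X T)"
  using assms transitive_point_mean_equicontinuous mean_equicontinuous_point_not_mean_sensitive
  unfolding almost_mean_equicontinuous_def transitive_system_def by blast

end
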